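(* Let $a<b$ be real numbers. Assume that $g:[a,b]\to\mathbb{R}$ is differentiable (with finite derivative) almost everywhere on $[a,b]$ and that $f:\mathbb{R}\to\mathbb{R}$ is HK integrable on every closed interval with endpoints in the range of $g$. Define $F(x):=(HK)\int_{g(a)}^{x}f(u)\,du$ (for $x$ in the smallest interval containing the range of $g$). Then the following are equivalent: (i) $(f\circ g)\cdot g'$ is HK integrable on $[a,b]$ and $$(HK)\int_{g(\alpha)}^{g(\beta)}f(u)\,du=(HK)\int_{\alpha}^{\beta}f(g(s))\,g'(s)\,ds$$ holds for every $[\alpha,\beta]\subseteq[a,b]$; (ii) $F\circ g$ has negligible variation on each (Lebesgue) null subset of $[a,b]$ and on the set $\{x\in[a,b]:g'(x)=0\}$.
   Context: Derivatives are finite derivatives; at the endpoints of $[a,b]$ they are one-sided. A tagged partition of $[a,b]$ is a finite set $P=\{(x_j,I_j):1\le j\le n\}$ with closed intervals $I_j=[a_j,b_j]$, $x_j\in I_j$, $\bigcup_j I_j=[a,b]$, and $(a_i,b_i)\cap(a_j,b_j)=\emptyset$ for $i\ne j$. A gauge on $[a,b]$ is a function $\delta:[a,b]\to(0,\infty)$. $P$ is subordinate to $\delta$ if $I_j\subseteq(x_j-\delta(x_j),x_j+\delta(x_j))$ for every $j$. A function $\phi:[a,b]\to\mathbb{R}$ is HK (Henstock–Kurzweil) integrable over $[a,b]$ with integral $(HK)\int_a^b\phi(x)\,dx=A$ if for every $\epsilon>0$ there is a gauge $\delta$ on $[a,b]$ such that every tagged partition $P$ of $[a,b]$ subordinate to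 $\delta$ satisfies $\left|\sum_{j}\phi(x_j)(b_j-a_j)-A\right|<\epsilon$. One sets $(HK)\int_b^a\phi=-(HK)\int_a^b\phi$; the integral over a degenerate interval is $0$. If $\phi$ is only defined almost everywhere, its HK integral means that of the function equal to $\phi$ where $\phi$ is defined and $0$ elsewhere. A function $\phi:[a,b]\to\mathbb{R}$ has negligible variation on a set $E\subseteq[a,b]$ if for every $\epsilon>0$ there is a gauge $\delta$ on $[a,b]$ such that for every tagged partition $\{(x_j,[a_j,b_j]):1\le j\le n\}$ of $[a,b]$ subordinate to $\delta$, $\sum_{x_j\in E}|\phi(b_j)-\phi(a_j)|<\epsilon$. *)

theory Defs
  imports "HOL-Analysis.Analysis"
begin

text \<open>
  The Henstock--Kurzweil integral is the library's \<^const>\<open>has_integral\<close>,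
  \<^const>\<open>integrable_on\<close>, \<^const>\<open>integral\<close>. A function on \<open>[a,b]\<close> is a total function
  of which only the values on \<open>{a..b}\<close> are used; derivatives are taken
  \<open>at x within {a..b}\<close>, so they are one-sided at the endpoints.
\<close>

definition hk_integral :: "(real \<Rightarrow> real) \<Rightarrow> real \<Rightarrow> real \<Rightarrow> real" where
  "hk_integral f u v = (if u \<le> v then integral {u..v} f else - integral {v..u} f)"

definition real_derivative_on :: "(real \<Rightarrow> real) \<Rightarrow> real set \<Rightarrow> real \<Rightarrow> real" where
  "real_derivative_on g S x = (THE D. (g has_real_derivative D) (at x within S))"

text \<open>The product \<open>(f \<circ> g) \<cdot> g'\<close>, extended by \<open>0\<close> to the points where \<open>g'\<close> does not exist.\<close>

definition subst_integrand ::
  "(real \<Rightarrow> real) \<Rightarrow> (real \<Rightarrow> real) \<Rightarrow> real set \<Rightarrow> real \<Rightarrow> real" where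
  "subst_integrand f g S x =
     (if g differentiable (at x within S) then f (g x) * real_derivative_on g S x else 0)"

text \<open>
  For a member \<open>(x, K)\<close> of a tagged division of \<open>{a..b}\<close>, the set \<open>K\<close> is a nonempty compact
  interval with endpoints \<open>Inf K\<close> and \<open>Sup K\<close>. Degenerate intervals are allowed and
  contribute \<open>0\<close> to the sum.
\<close>

definition negligible_variation_on ::
  "real \<Rightarrow> real \<Rightarrow> (real \<Rightarrow> real) \<Rightarrow> real set \<Rightarrow> bool" where
  "negligible_variation_on a b \<phi> E \<longleftrightarrow>
     (\<forall>\<epsilon>>0. \<exists>\<delta>. (\<forall>x\<in>{a..b}. 0 < \<delta> x) \<and>
        (\<forall>p. p tagged_division_of {a..b} \<and> (\<lambda>x. {x - \<delta> x<..<x + \<delta> x}) fine p \<longrightarrow>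
           (\<Sum>(x, K)\<in>{(x, K)\<in>p. x \<in> E}. \<bar>\<phi> (Sup K) - \<phi> (Inf K)\<bar>) < \<epsilon>))"

end

theory Submission
  imports Defs
begin

text \<open>
  Write \<open>\<Phi> = F \<circ> g\<close> and \<open>h = (f \<circ> g) \<cdot> g'\<close>. By additivity of the integral,
  \<open>\<Phi> v - \<Phi> u\<close> is the integral of \<open>f\<close> from \<open>g u\<close> to \<open>g v\<close>, so (i) says that \<open>\<Phi>\<close> is an
  indefinite integral of \<open>h\<close>.

  If it is, Henstock's lemma makes the sum of
  \<open>\<bar>\<Phi> v - \<Phi> u - h x (v - u)\<bar>\<close> over the members \<open>(x, {u..v})\<close> of a fine division small.
  Over the tags in a set on which \<open>h\<close> vanishes, this is the variation sum of \<open>\<Phi>\<close>. On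
  the set where \<open>g' = 0\<close> the function \<open>h\<close> vanishes; on a null set it can be made to vanish,
  since this changes no integral (\<open>negligible_variation_on_indefinite_integral\<close>).

  Conversely, there is a null set \<open>N\<close> such that \<open>\<Phi>' = h\<close> wherever \<open>x \<notin> N\<close> and \<open>g' x \<noteq> 0\<close>
  (\<open>hk_integral_comp_has_derivative_outside_negligible\<close>). Indeed \<open>F' = f\<close> on the range of \<open>g\<close> outside a null
  set \<open>Z\<close>, and the preimage of \<open>Z\<close> under \<open>g\<close> is null within the set where \<open>g'\<close> exists and
  is nonzero; elsewhere the chain rule applies. Replace \<open>h\<close> by \<open>0\<close> on \<open>N\<close>. In the Riemann
  sums for a small gauge, the tags in \<open>N\<close> and those with \<open>g' x = 0\<close> contribute nothing, and the
  corresponding increments of \<open>\<Phi>\<close> are negligible by (ii); at all other tags the increment of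
  \<open>\<Phi>\<close> is close to its linear approximation. So the increments of \<open>\<Phi>\<close> are the integrals of
  \<open>h\<close> (\<open>has_integral_if_negligible_variation\<close>).
\<close>

section \<open>Derivatives of indefinite Henstock--Kurzweil integrals\<close>

lemma hk_integral_additive:
  assumes "f integrable_on {l..r}" and "u \<in> {l..r}" "v \<in> {l..r}" "w \<in> {l..r}"
  shows "hk_integral f u v + hk_integral f v w = hk_integral f u w"
proof -
  have "hk_integral f x y = integral {l..y} f - integral {l..x} f"
    if "x \<in> {l..r}" "y \<in> {l..r}" for x y
  proof -
    have comb: "integral {l..s} f + integral {s..t} f = integral {l..t} f"
      if "l \<le> s" "s \<le> t" "t \<le> r" for s t
      using that integrable_on_subinterval[OF assms(1), of l t]
      by (intro Henstock_Kurzweil_Integration.integral_combine) auto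
    show ?thesis
      using that comb[of x y] comb[of y x] by (cases "x \<le> y") (simp_all add: hk_integral_def)
  qed
  then show ?thesis
    using assms(2-) by simp
qed

text \<open>
  The one-sided averages over \<open>{y..y + h}\<close> of a function that is integrable on every interval
  converge to its value almost everywhere. Reflection gives the averages over \<open>{y - h..y}\<close>, and
  the two limits together are the derivative.
\<close>

lemma integral_has_derivative_outside_negligible:
  fixes f :: "real \<Rightarrow> real"
  assumes f: "f integrable_on {p..q}"
  obtains Z where "negligible Z"
    and "\<And>y. y \<in> {p<..<q} - Z \<Longrightarrow>
           ((\<lambda>z. integral {p..z} f) has_real_derivative f y) (at y)"
proof -
  define fE where "fE \<equiv> \<lambda>x. if x \<in> {p..q} then f x else 0"
  have UN: "fE integrable_on UNIV"
    using f unfolding fE_def integrable_restrict_UNIV .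
  have int: "fE integrable_on cbox u v" for u v
    using integrable_on_subcbox[OF UN] by simp
  have int': "(\<lambda>x. fE (- x)) integrable_on cbox u v" for u v
    using int[of "-v" "-u"] integrable_reflect[of fE "-u" "-v"] by (simp only: minus_minus)
  obtain N1 where N1: "negligible N1" and R: "\<And>x e. x \<notin> N1 \<Longrightarrow> 0 < e \<Longrightarrow>
      \<exists>d>0. \<forall>h. 0 < h \<and> h < d \<longrightarrow>
        norm (integral (cbox x (x + h *\<^sub>R One)) fE /\<^sub>R h ^ DIM(real) - fE x) < e"
    using integrable_ccontinuous_explicit[of fE] int by metis
  obtain N2 where N2: "negligible N2" and L: "\<And>x e. x \<notin> N2 \<Longrightarrow> 0 < e \<Longrightarrow>
      \<exists>d>0. \<forall>h. 0 < h \<and> h < d \<longrightarrow>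
        norm (integral (cbox x (x + h *\<^sub>R One)) (\<lambda>x. fE (- x)) /\<^sub>R h ^ DIM(real)
              - fE (- x)) < e"
    using integrable_ccontinuous_explicit[of "\<lambda>x. fE (- x)"] int' by metis
  have N2': "negligible (uminus ` N2)"
    using N2 by (intro negligible_differentiable_image_negligible) (auto intro: derivative_intros)
  show ?thesis
  proof
    show "negligible (N1 \<union> uminus ` N2)"
      using N1 N2' by (rule negligible_Un)
  next
    fix y assume y: "y \<in> {p<..<q} - (N1 \<union> uminus ` N2)"
    have y2: "- y \<notin> N2"
      using y by force
    have sub: "integral {u..v} fE = integral {u..v} f" if "p \<le> u" "v \<le> q" for u v
      using that by (intro integral_cong) (auto simp: fE_def)
    show "((\<lambda>z. integral {p..z} f) has_real_derivative f y) (at y)"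
      unfolding has_field_derivative_iff
    proof (rule LIM_I)
      fix e :: real assume e: "0 < e"
      obtain d1 where d1: "d1 > 0" "\<And>h. 0 < h \<Longrightarrow> h < d1 \<Longrightarrow>
          \<bar>integral {y..y+h} fE / h - fE y\<bar> < e"
        using R[of y e] y e by (auto simp: field_simps)
      obtain d2 where d2: "d2 > 0" "\<And>h. 0 < h \<Longrightarrow> h < d2 \<Longrightarrow>
          \<bar>integral {-y..-y+h} (\<lambda>x. fE (- x)) / h - fE y\<bar> < e"
        using L[of "-y" e] y2 e by (auto simp: field_simps)
      define d where "d = Min {d1, d2, y - p, q - y}"
      have d: "d > 0" "d \<le> d1" "d \<le> d2" "d \<le> y - p" "d \<le> q - y"
        using d1 d2 y by (auto simp: d_def)
      have fy: "fE y = f y"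
        using y by (simp add: fE_def)
      have comb: "integral {p..u} f + integral {u..v} f = integral {p..v} f"
        if "p \<le> u" "u \<le> v" "v \<le> q" for u v
        using that f by (intro Henstock_Kurzweil_Integration.integral_combine)
            (auto intro: integrable_on_subinterval)
      have "norm ((integral {p..z} f - integral {p..y} f) / (z - y) - f y) < e"
        if z: "z \<noteq> y" "norm (z - y) < d" for z
      proof (cases "y < z")
        case True
        have "integral {p..z} f - integral {p..y} f = integral {y..z} f"
          using comb[of y z] y d z True by simp
        then show ?thesis
          using d1(2)[of "z - y"] sub[of y z] y d z fy True by simp
      next
        case False
        have eq: "integral {-y..-z} (\<lambda>x. fE (- x)) = integral {z..y} fE"
          using integral_reflect_real[of y z fE] by simp
        have "(integral {p..z} f - integral {p..y} f) / (z - y) = integral {z..y} f / (y - z)"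
        proof -
          have "integral {p..z} f - integral {p..y} f = - integral {z..y} f"
            using comb[of z y] y d z False by simp
          then show ?thesis
            using minus_divide_right[of "integral {z..y} f" "z - y"] by simp
        qed
        then show ?thesis
          using d2(2)[of "y - z"] eq sub[of z y] y d z fy False by simp
      qed
      then show "\<exists>s>0. \<forall>z. z \<noteq> y \<and> norm (z - y) < s \<longrightarrow>
          norm ((integral {p..z} f - integral {p..y} f) / (z - y) - f y) < e"
        using d(1) by blast
    qed
  qed
qed

text \<open>
  The set \<open>R\<close> stands for the range of \<open>g\<close>. It may be unbounded and need not be connected, and \<open>f\<close>
  need not be integrable on its convex hull. So the exceptional set is assembled from
  countably many compact intervals with rational endpoints. Each point of \<open>R\<close> lying strictly
  between two others is interior to such an interval; a least or greatest element of \<open>R\<close> is put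
  into the exceptional set, because \<open>f\<close> is uncontrolled on its far side.
\<close>

lemma hk_integral_has_derivative_outside_negligible:
  fixes f :: "real \<Rightarrow> real"
  assumes f: "\<And>u v. u \<in> R \<Longrightarrow> v \<in> R \<Longrightarrow> u \<le> v \<Longrightarrow> f integrable_on {u..v}"
    and c: "c \<in> R"
  obtains Z where "negligible Z"
    and "\<And>y. y \<in> R - Z \<Longrightarrow> (hk_integral f c has_real_derivative f y) (at y)"
proof -
  have "\<exists>Z. negligible Z \<and> (f integrable_on {p..q} \<longrightarrow>
      (\<forall>y\<in>{p<..<q} - Z. ((\<lambda>z. integral {p..z} f) has_real_derivative f y) (at y)))" for p q
  proof (cases "f integrable_on {p..q}")
    case True
    then show ?thesis
      using integral_has_derivative_outside_negligible by metis
  qed (use negligible_empty in blast)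
  then obtain Zf where Zf: "\<And>p q. negligible (Zf p q)"
    and der: "\<And>p q y. f integrable_on {p..q} \<Longrightarrow> y \<in> {p<..<q} - Zf p q \<Longrightarrow>
        ((\<lambda>z. integral {p..z} f) has_real_derivative f y) (at y)"
    by metis
  define Z1 where "Z1 = (\<Union>(p, q)\<in>\<rat> \<times> \<rat>. Zf p q)"
  define Z2 where "Z2 = {y\<in>R. \<forall>z\<in>R. y \<le> z} \<union> {y\<in>R. \<forall>z\<in>R. z \<le> y}"
  have "negligible (\<Union>((\<lambda>(p, q). Zf p q) ` (\<rat> \<times> \<rat>)))"
    using Zf by (intro negligible_countable_Union) (auto simp: countable_rat)
  then have Z1: "negligible Z1"
    by (simp add: Z1_def)
  have "negligible {y\<in>R. \<forall>z\<in>R. y \<le> z}"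
  proof (cases "{y\<in>R. \<forall>z\<in>R. y \<le> z} = {}")
    case False
    then obtain y where "y \<in> R" "\<forall>z\<in>R. y \<le> z" by blast
    then have "{y\<in>R. \<forall>z\<in>R. y \<le> z} \<subseteq> {y}" by force
    then show ?thesis using negligible_subset negligible_sing by blast
  next
    case True
    then show ?thesis by (simp only: negligible_empty)
  qed
  moreover have "negligible {y\<in>R. \<forall>z\<in>R. z \<le> y}"
  proof (cases "{y\<in>R. \<forall>z\<in>R. z \<le> y} = {}")
    case False
    then obtain y where "y \<in> R" "\<forall>z\<in>R. z \<le> y" by blast
    then have "{y\<in>R. \<forall>z\<in>R. z \<le> y} \<subseteq> {y}" by force
    then show ?thesis using negligible_subset negligible_sing by blast
  next
    case True
    then show ?thesis by (simp only: negligible_empty)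
  qed
  ultimately have Z2: "negligible Z2"
    unfolding Z2_def by (rule negligible_Un)
  show ?thesis
  proof
    show "negligible (Z1 \<union> Z2)"
      using Z1 Z2 by (rule negligible_Un)
  next
    fix y assume y: "y \<in> R - (Z1 \<union> Z2)"
    obtain s t where st: "s \<in> R" "t \<in> R" "s < y" "y < t"
      using y by (force simp: Z2_def not_le)
    \<comment> \<open>The interval has to contain the base point \<open>c\<close>, so that additivity moves it to \<open>p\<close>.\<close>
    define l r where "l = min s c" and "r = max t c"
    have lr: "l \<in> R" "r \<in> R" "l < y" "y < r" "c \<in> {l..r}"
      using st c by (auto simp: l_def r_def min_def max_def)
    have fi: "f integrable_on {l..r}"
      using f lr by simp
    obtain p q where pq: "p \<in> \<rat>" "q \<in> \<rat>" "l < p" "p < y" "y < q" "q < r"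
      using Rats_dense_in_real[OF lr(3)] Rats_dense_in_real[OF lr(4)] by blast
    have fpq: "f integrable_on {p..q}"
      using fi by (rule integrable_on_subinterval) (use pq in auto)
    have "y \<notin> Zf p q"
      using y pq by (auto simp: Z1_def)
    then have "((\<lambda>z. integral {p..z} f) has_real_derivative f y) (at y)"
      using der[OF fpq] pq by simp
    then have D: "((\<lambda>z. hk_integral f c p + integral {p..z} f) has_real_derivative f y) (at y)"
      using DERIV_add[OF DERIV_const] by fastforce
    show "(hk_integral f c has_real_derivative f y) (at y)"
    proof (rule has_field_derivative_transform_within_open[OF D])
      show "open {p<..<q}" "y \<in> {p<..<q}" using pq by auto
    next
      fix z assume "z \<in> {p<..<q}"
      then show "hk_integral f c p + integral {p..z} f = hk_integral f c z"
        using hk_integral_additive[OF fi lr(5), of p z] pq by (simp add: hk_integral_def)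
    qed
  qed
qed

section \<open>Negligible variation\<close>

lemma fine_mono: "\<gamma> fine p \<Longrightarrow> (\<And>x. \<gamma> x \<subseteq> \<gamma>' x) \<Longrightarrow> \<gamma>' fine p"
  unfolding fine_def by blast

lemma gauge_of_positive_radius:
  fixes \<delta> :: "real \<Rightarrow> real"
  assumes "\<forall>x\<in>{a..b}. 0 < \<delta> x"
  obtains \<gamma> where "gauge \<gamma>"
    and "\<And>p. p tagged_division_of {u..v} \<Longrightarrow> a \<le> u \<Longrightarrow> v \<le> b \<Longrightarrow> \<gamma> fine p \<Longrightarrow>
           (\<lambda>x. {x - \<delta> x<..<x + \<delta> x}) fine p"
proof
  \<comment> \<open>A gauge is defined on the whole line, so the radius needs a positive default value.\<close>
  let ?r = "\<lambda>x. if x \<in> {a..b} then \<delta> x else 1"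
  show "gauge (\<lambda>x. {x - ?r x<..<x + ?r x})"
    using assms by (auto simp: gauge_def)
next
  let ?r = "\<lambda>x. if x \<in> {a..b} then \<delta> x else 1"
  fix p assume p: "p tagged_division_of {u..v}" "a \<le> u" "v \<le> b"
    "(\<lambda>x. {x - ?r x<..<x + ?r x}) fine p"
  have "x \<in> {a..b}" if "(x, K) \<in> p" for x K
    using tag_in_interval[OF p(1) that] p(2,3) by auto
  then show "(\<lambda>x. {x - \<delta> x<..<x + \<delta> x}) fine p"
    using p(4) unfolding fine_def by fastforce
qed

lemma positive_radius_of_gauge:
  fixes \<gamma> :: "real \<Rightarrow> real set"
  assumes "gauge \<gamma>"
  obtains \<delta> where "\<And>x. 0 < \<delta> x"
    and "\<And>p. (\<lambda>x. {x - \<delta> x<..<x + \<delta> x}) fine p \<Longrightarrow> \<gamma> fine p"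
proof -
  have "\<exists>d>0. {x - d<..<x + d} \<subseteq> \<gamma> x" for x
    using assms unfolding gauge_def open_contains_ball
    by (metis ball_eq_greaterThanLessThan)
  then obtain \<delta> where \<delta>: "\<And>x. 0 < \<delta> x" "\<And>x. {x - \<delta> x<..<x + \<delta> x} \<subseteq> \<gamma> x"
    by metis
  show ?thesis
    using \<delta>(1)
  proof (rule that)
    fix p assume "(\<lambda>x. {x - \<delta> x<..<x + \<delta> x}) fine p"
    then show "\<gamma> fine p"
      using \<delta>(2) by (rule fine_mono)
  qed
qed

lemma tagged_division_member_real:
  fixes x u v :: real
  assumes "p tagged_division_of {u..v}" "(x, K) \<in> p"
  shows "K = {Inf K..Sup K}" "Inf K \<le> x" "x \<le> Sup K" "u \<le> Inf K" "Sup K \<le> v"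
    "measure lborel K = Sup K - Inf K"
proof -
  obtain c d where K: "K = {c..d}"
    using tagged_division_ofD(4)[OF assms] by (auto simp: box_real)
  moreover have "x \<in> K" "K \<subseteq> {u..v}"
    using assms by (auto dest: tagged_division_ofD)
  ultimately show "K = {Inf K..Sup K}" "Inf K \<le> x" "x \<le> Sup K" "u \<le> Inf K" "Sup K \<le> v"
    "measure lborel K = Sup K - Inf K"
    by auto
qed

lemma negligible_variation_onE:
  assumes "negligible_variation_on a b \<phi> E" "0 < \<epsilon>"
  obtains \<delta> where "\<forall>x\<in>{a..b}. 0 < \<delta> x"
    and "\<And>p. p tagged_division_of {a..b} \<Longrightarrow> (\<lambda>x. {x - \<delta> x<..<x + \<delta> x}) fine p \<Longrightarrow>
           (\<Sum>(x, K)\<in>{(x, K)\<in>p. x \<in> E}. \<bar>\<phi> (Sup K) - \<phi> (Inf K)\<bar>) < \<epsilon>"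
proof -
  from assms(1)[unfolded negligible_variation_on_def, THEN spec, THEN mp, OF assms(2)]
  obtain \<delta> where \<delta>: "(\<forall>x\<in>{a..b}. 0 < \<delta> x) \<and>
        (\<forall>p. p tagged_division_of {a..b} \<and> (\<lambda>x. {x - \<delta> x<..<x + \<delta> x}) fine p \<longrightarrow>
           (\<Sum>(x, K)\<in>{(x, K)\<in>p. x \<in> E}. \<bar>\<phi> (Sup K) - \<phi> (Inf K)\<bar>) < \<epsilon>)" ..
  show thesis
    by (rule that[OF conjunct1[OF \<delta>] conjunct2[OF \<delta>, THEN spec, THEN mp, OF conjI]])
qed

lemma negligible_variation_onI:
  assumes "\<And>\<epsilon>. 0 < \<epsilon> \<Longrightarrow> \<exists>\<delta>. (\<forall>x\<in>{a..b}. 0 < \<delta> x) \<and>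
        (\<forall>p. p tagged_division_of {a..b} \<longrightarrow> (\<lambda>x. {x - \<delta> x<..<x + \<delta> x}) fine p \<longrightarrow>
           (\<Sum>(x, K)\<in>{(x, K)\<in>p. x \<in> E}. \<bar>\<phi> (Sup K) - \<phi> (Inf K)\<bar>) < \<epsilon>)"
  shows "negligible_variation_on a b \<phi> E"
  unfolding negligible_variation_on_def imp_conjL[of "_ tagged_division_of _"] using assms by (intro allI impI)

lemma negligible_variation_on_Un:
  assumes A: "negligible_variation_on a b \<phi> A" and B: "negligible_variation_on a b \<phi> B"
  shows "negligible_variation_on a b \<phi> (A \<union> B)"
proof (rule negligible_variation_onI)
  fix \<epsilon> :: real assume "0 < \<epsilon>"
  then have e: "0 < \<epsilon> / 2" by simp
  let ?V = "\<lambda>E p. \<Sum>(x, K)\<in>{(x, K)\<in>p. x \<in> E}. \<bar>\<phi> (Sup K) - \<phi> (Inf K)\<bar>"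
  obtain \<delta>1 where \<delta>1: "\<forall>x\<in>{a..b}. 0 < \<delta>1 x"
    "\<And>p. p tagged_division_of {a..b} \<Longrightarrow> (\<lambda>x. {x - \<delta>1 x<..<x + \<delta>1 x}) fine p \<Longrightarrow> ?V A p < \<epsilon>/2"
    by (rule negligible_variation_onE[OF A e]) blast
  obtain \<delta>2 where \<delta>2: "\<forall>x\<in>{a..b}. 0 < \<delta>2 x"
    "\<And>p. p tagged_division_of {a..b} \<Longrightarrow> (\<lambda>x. {x - \<delta>2 x<..<x + \<delta>2 x}) fine p \<Longrightarrow> ?V B p < \<epsilon>/2"
    by (rule negligible_variation_onE[OF B e]) blast
  define \<delta> where "\<delta> = (\<lambda>x. min (\<delta>1 x) (\<delta>2 x))"
  have "?V (A \<union> B) p < \<epsilon>" if p: "p tagged_division_of {a..b}"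
    and fine: "(\<lambda>x. {x - \<delta> x<..<x + \<delta> x}) fine p" for p
  proof -
    have fin: "finite p"
      using p by blast
    have "(\<lambda>x. {x - \<delta>1 x<..<x + \<delta>1 x}) fine p" "(\<lambda>x. {x - \<delta>2 x<..<x + \<delta>2 x}) fine p"
      by (rule fine_mono[OF fine], force simp: \<delta>_def)+
    then have "?V A p < \<epsilon>/2" "?V B p < \<epsilon>/2"
      using \<delta>1(2) \<delta>2(2) p by blast+
    moreover have "{(x, K)\<in>p. x \<in> A \<union> B} = {(x, K)\<in>p. x \<in> A} \<union> {(x, K)\<in>p. x \<in> B}"
      by auto
    moreover have "finite {(x, K)\<in>p. x \<in> E}" for E
      using fin by (rule rev_finite_subset) auto
    moreover have "0 \<le> (\<Sum>(x, K)\<in>{(x, K)\<in>p. x \<in> A} \<inter> {(x, K)\<in>p. x \<in> B}. \<bar>\<phi> (Sup K) - \<phi> (Inf K)\<bar>)"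
      by (intro sum_nonneg) auto
    ultimately show ?thesis
      by (simp add: sum_Un)
  qed
  then show "\<exists>\<delta>. (\<forall>x\<in>{a..b}. 0 < \<delta> x) \<and>
        (\<forall>p. p tagged_division_of {a..b} \<longrightarrow> (\<lambda>x. {x - \<delta> x<..<x + \<delta> x}) fine p \<longrightarrow> ?V (A \<union> B) p < \<epsilon>)"
    using \<delta>1(1) \<delta>2(1) by (intro exI[of _ \<delta>]) (auto simp: \<delta>_def)
qed

text \<open>
  A fine division of the subinterval extends to a fine division of the whole interval, and the
  additional members only increase the variation sum.
\<close>

lemma negligible_variation_on_subinterval:
  assumes nv: "negligible_variation_on a b \<phi> E" and "a \<le> \<alpha>" "\<alpha> \<le> \<beta>" "\<beta> \<le> b"
  shows "negligible_variation_on \<alpha> \<beta> \<phi> E"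
proof (rule negligible_variation_onI)
  fix \<epsilon> :: real assume e: "0 < \<epsilon>"
  let ?V = "\<lambda>p. \<Sum>(x, K)\<in>{(x, K)\<in>p. x \<in> E}. \<bar>\<phi> (Sup K) - \<phi> (Inf K)\<bar>"
  obtain \<delta> where \<delta>: "\<forall>x\<in>{a..b}. 0 < \<delta> x"
    "\<And>p. p tagged_division_of {a..b} \<Longrightarrow> (\<lambda>x. {x - \<delta> x<..<x + \<delta> x}) fine p \<Longrightarrow> ?V p < \<epsilon>"
    by (rule negligible_variation_onE[OF nv e]) blast
  have ext: "\<exists>p. p tagged_division_of {u..v} \<and> (\<lambda>x. {x - \<delta> x<..<x + \<delta> x}) fine p"
    if "a \<le> u" "v \<le> b" for u v
    using gauge_of_positive_radius[OF \<delta>(1), of u v] fine_division_exists_real that by metis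
  obtain p1 where p1: "p1 tagged_division_of {a..\<alpha>}" "(\<lambda>x. {x - \<delta> x<..<x + \<delta> x}) fine p1"
    using ext[of a \<alpha>] assms by auto
  obtain p2 where p2: "p2 tagged_division_of {\<beta>..b}" "(\<lambda>x. {x - \<delta> x<..<x + \<delta> x}) fine p2"
    using ext[of \<beta> b] assms by auto
  have "?V p < \<epsilon>" if p: "p tagged_division_of {\<alpha>..\<beta>}"
    and fine: "(\<lambda>x. {x - \<delta> x<..<x + \<delta> x}) fine p" for p
  proof -
    have "(p1 \<union> p) tagged_division_of ({a..\<alpha>} \<union> {\<alpha>..\<beta>})"
      by (rule tagged_division_Un[OF p1(1) p]) (auto simp: interior_atLeastAtMost_real)
    then have q1: "(p1 \<union> p) tagged_division_of {a..\<beta>}"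
      using assms by (simp add: ivl_disj_un_two_touch)
    have "(p1 \<union> p \<union> p2) tagged_division_of ({a..\<beta>} \<union> {\<beta>..b})"
      by (rule tagged_division_Un[OF q1 p2(1)]) (auto simp: interior_atLeastAtMost_real)
    then have q: "(p1 \<union> p \<union> p2) tagged_division_of {a..b}"
      using assms by (simp add: ivl_disj_un_two_touch)
    have "?V p \<le> ?V (p1 \<union> p \<union> p2)"
    proof (rule sum_mono2)
      show "finite {(x, K)\<in>p1 \<union> p \<union> p2. x \<in> E}"
        by (rule rev_finite_subset[OF tagged_division_of_finite[OF q]]) auto
    qed auto
    also have "\<dots> < \<epsilon>"
      using q by (rule \<delta>(2)) (intro fine_Un p1 p2 fine)
    finally show ?thesis .
  qed
  then show "\<exists>\<delta>. (\<forall>x\<in>{\<alpha>..\<beta>}. 0 < \<delta> x) \<and>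
        (\<forall>p. p tagged_division_of {\<alpha>..\<beta>} \<longrightarrow> (\<lambda>x. {x - \<delta> x<..<x + \<delta> x}) fine p \<longrightarrow> ?V p < \<epsilon>)"
    using \<delta>(1) assms by (intro exI[of _ \<delta>]) auto
qed

text \<open>
  Henstock's lemma applied to the members with tag in \<open>E\<close>: their Riemann terms are \<open>0\<close>, so only
  the increments of \<open>\<phi>\<close> remain.
\<close>

lemma negligible_variation_on_indefinite_integral:
  assumes h: "h integrable_on {a..b}"
    and \<phi>: "\<And>u v. a \<le> u \<Longrightarrow> u \<le> v \<Longrightarrow> v \<le> b \<Longrightarrow> \<phi> v - \<phi> u = integral {u..v} h"
    and zero: "\<And>x. x \<in> E \<Longrightarrow> h x = 0"
  shows "negligible_variation_on a b \<phi> E"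
proof (rule negligible_variation_onI)
  fix \<epsilon> :: real assume e: "0 < \<epsilon>"
  have "h integrable_on cbox a b"
    using h by simp
  from Henstock_lemma[OF this e]
  obtain \<gamma> where \<gamma>: "gauge \<gamma>"
    "\<And>p. p tagged_partial_division_of cbox a b \<Longrightarrow> \<gamma> fine p \<Longrightarrow>
       (\<Sum>(x, K)\<in>p. norm (measure lborel K *\<^sub>R h x - integral K h)) < \<epsilon>"
    by blast
  obtain \<delta> where \<delta>: "\<And>x. 0 < \<delta> x"
    "\<And>p. (\<lambda>x. {x - \<delta> x<..<x + \<delta> x}) fine p \<Longrightarrow> \<gamma> fine p"
    using positive_radius_of_gauge[OF \<gamma>(1)] by metis
  have "(\<Sum>(x, K)\<in>{(x, K)\<in>p. x \<in> E}. \<bar>\<phi> (Sup K) - \<phi> (Inf K)\<bar>) < \<epsilon>"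
    if p: "p tagged_division_of {a..b}"
      and fine: "(\<lambda>x. {x - \<delta> x<..<x + \<delta> x}) fine p" for p
  proof -
    let ?q = "{(x, K)\<in>p. x \<in> E}"
    have "?q \<subseteq> p" by auto
    then have "?q tagged_partial_division_of cbox a b" "\<gamma> fine ?q"
      using p \<delta>(2)[OF fine] tagged_partial_division_subset fine_subset
      by (auto simp: tagged_division_of_def)
    then have "(\<Sum>(x, K)\<in>?q. norm (measure lborel K *\<^sub>R h x - integral K h)) < \<epsilon>"
      by (rule \<gamma>(2))
    moreover have "(\<Sum>(x, K)\<in>?q. norm (measure lborel K *\<^sub>R h x - integral K h))
        = (\<Sum>(x, K)\<in>?q. \<bar>\<phi> (Sup K) - \<phi> (Inf K)\<bar>)"
    proof (rule sum.cong[OF refl], clarify)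
      fix x K assume xK: "(x, K) \<in> p" "x \<in> E"
      note m = tagged_division_member_real[OF p xK(1)]
      have "integral K h = \<phi> (Sup K) - \<phi> (Inf K)"
        using \<phi>[of "Inf K" "Sup K"] m by auto
      then show "norm (measure lborel K *\<^sub>R h x - integral K h) = \<bar>\<phi> (Sup K) - \<phi> (Inf K)\<bar>"
        using zero xK(2) by simp
    qed
    ultimately show ?thesis by simp
  qed
  then show "\<exists>\<delta>. (\<forall>x\<in>{a..b}. 0 < \<delta> x) \<and>
        (\<forall>p. p tagged_division_of {a..b} \<longrightarrow> (\<lambda>x. {x - \<delta> x<..<x + \<delta> x}) fine p \<longrightarrow>
           (\<Sum>(x, K)\<in>{(x, K)\<in>p. x \<in> E}. \<bar>\<phi> (Sup K) - \<phi> (Inf K)\<bar>) < \<epsilon>)"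
    using \<delta>(1) by blast
qed

lemma straddle_estimate:
  fixes \<phi> :: "real \<Rightarrow> real"
  assumes "(\<phi> has_real_derivative D) (at x within S)" "0 < e"
  obtains d where "0 < d"
    "\<And>u v. u \<in> S \<Longrightarrow> v \<in> S \<Longrightarrow> x - d < u \<Longrightarrow> u \<le> x \<Longrightarrow> x \<le> v \<Longrightarrow> v < x + d \<Longrightarrow>
       \<bar>(v - u) * D - (\<phi> v - \<phi> u)\<bar> \<le> e * (v - u)"
proof -
  have "(\<phi> has_derivative (*) D) (at x within S)"
    using assms(1) by (simp add: has_field_derivative_def)
  then obtain d where d: "d > 0" "\<And>y. y \<in> S \<Longrightarrow> \<bar>y - x\<bar> < d \<Longrightarrow>
      \<bar>\<phi> y - \<phi> x - D * (y - x)\<bar> \<le> e * \<bar>y - x\<bar>"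
    unfolding has_derivative_within_alt using assms(2) by (auto simp: real_norm_def)
  show ?thesis
  proof (rule that[OF d(1)])
    fix u v assume uv: "u \<in> S" "v \<in> S" "x - d < u" "u \<le> x" "x \<le> v" "v < x + d"
    then have "\<bar>\<phi> u - \<phi> x - D * (u - x)\<bar> \<le> e * (x - u)" "\<bar>\<phi> v - \<phi> x - D * (v - x)\<bar> \<le> e * (v - x)"
      using d(2)[of u] d(2)[of v] by auto
    then show "\<bar>(v - u) * D - (\<phi> v - \<phi> u)\<bar> \<le> e * (v - u)"
      by (simp add: algebra_simps abs_le_iff)
  qed
qed

text \<open>
  A form of the fundamental theorem of calculus with an exceptional set that may have positive
  measure. The increments of \<open>\<phi>\<close> over a division telescope to \<open>\<phi> b - \<phi> a\<close>. The gauge is the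
  smaller of two: one controls the increments with tag in \<open>E\<close>, the other is the straddle
  estimate at the remaining tags.
\<close>

lemma has_integral_if_negligible_variation:
  fixes h \<phi> :: "real \<Rightarrow> real"
  assumes "a \<le> b"
    and nv: "negligible_variation_on a b \<phi> E"
    and der: "\<And>x. x \<in> {a..b} - E \<Longrightarrow> (\<phi> has_real_derivative h x) (at x within {a..b})"
    and zero: "\<And>x. x \<in> E \<Longrightarrow> h x = 0"
  shows "(h has_integral (\<phi> b - \<phi> a)) {a..b}"
  unfolding has_integral_real
proof (intro allI impI)
  fix \<epsilon> :: real assume e: "0 < \<epsilon>"
  \<comment> \<open>The denominator \<open>b - a + 1\<close> keeps \<open>e1\<close> positive also when \<open>a = b\<close>.\<close>
  define e1 where "e1 = \<epsilon> / (2 * (b - a + 1))"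
  have e1: "e1 > 0" "e1 * (b - a) \<le> \<epsilon> / 2"
    using e \<open>a \<le> b\<close> by (auto simp: e1_def field_simps)
  let ?W = "\<lambda>K. \<phi> (Sup K) - \<phi> (Inf K)"
  have e2: "0 < \<epsilon> / 2"
    using e by simp
  obtain \<delta> where \<delta>: "\<forall>x\<in>{a..b}. 0 < \<delta> x"
    "\<And>p. p tagged_division_of {a..b} \<Longrightarrow> (\<lambda>x. {x - \<delta> x<..<x + \<delta> x}) fine p \<Longrightarrow>
       (\<Sum>(x, K)\<in>{(x, K)\<in>p. x \<in> E}. \<bar>?W K\<bar>) < \<epsilon> / 2"
    by (rule negligible_variation_onE[OF nv e2]) blast
  have "\<exists>d>0. x \<in> {a..b} - E \<longrightarrow>
     (\<forall>u v. u \<in> {a..b} \<and> v \<in> {a..b} \<and> x - d < u \<and> u \<le> x \<and> x \<le> v \<and> v < x + d \<longrightarrow>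
       \<bar>(v - u) * h x - (\<phi> v - \<phi> u)\<bar> \<le> e1 * (v - u))" for x
  proof (cases "x \<in> {a..b} - E")
    case True
    show ?thesis
      using straddle_estimate[OF der[OF True] e1(1)] by metis
  next
    case False
    then show ?thesis
      using zero_less_one by blast
  qed
  then obtain d where d: "\<And>x. 0 < d x"
    "\<And>x u v. x \<in> {a..b} - E \<Longrightarrow> u \<in> {a..b} \<Longrightarrow> v \<in> {a..b} \<Longrightarrow> x - d x < u \<Longrightarrow> u \<le> x \<Longrightarrow>
       x \<le> v \<Longrightarrow> v < x + d x \<Longrightarrow> \<bar>(v - u) * h x - (\<phi> v - \<phi> u)\<bar> \<le> e1 * (v - u)"
    by metis
  define \<eta> where "\<eta> = (\<lambda>x. min (\<delta> x) (d x))"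
  have "\<forall>x\<in>{a..b}. 0 < \<eta> x"
    using \<delta>(1) d(1) by (simp add: \<eta>_def)
  then obtain \<gamma> where \<gamma>: "gauge \<gamma>"
    "\<And>p. p tagged_division_of {a..b} \<Longrightarrow> \<gamma> fine p \<Longrightarrow> (\<lambda>x. {x - \<eta> x<..<x + \<eta> x}) fine p"
    using gauge_of_positive_radius[of a b \<eta> a b] by (metis order_refl)
  have "norm ((\<Sum>(x, K)\<in>p. measure lborel K *\<^sub>R h x) - (\<phi> b - \<phi> a)) < \<epsilon>"
    if p: "p tagged_division_of {a..b}" and "\<gamma> fine p" for p
  proof -
    have fine: "(\<lambda>x. {x - \<eta> x<..<x + \<eta> x}) fine p"
      using \<gamma>(2) that by blast
    then have fine\<delta>: "(\<lambda>x. {x - \<delta> x<..<x + \<delta> x}) fine p"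
      by (rule fine_mono) (auto simp: \<eta>_def)
    let ?q = "{(x, K)\<in>p. x \<in> E}"
    have fin: "finite p"
      using p by blast
    have q: "?q \<subseteq> p" by auto
    have tele: "(\<Sum>(x, K)\<in>p. \<psi> (Sup K) - \<psi> (Inf K)) = \<psi> b - \<psi> a" for \<psi> :: "real \<Rightarrow> real"
      using additive_tagged_division_1[OF \<open>a \<le> b\<close> p] .
    have E: "(\<Sum>(x, K)\<in>?q. \<bar>measure lborel K * h x - ?W K\<bar>) < \<epsilon> / 2"
    proof -
      have "(\<Sum>(x, K)\<in>?q. \<bar>measure lborel K * h x - ?W K\<bar>) = (\<Sum>(x, K)\<in>?q. \<bar>?W K\<bar>)"
        by (rule sum.cong) (auto simp: zero)
      then show ?thesis
        using \<delta>(2)[OF p fine\<delta>] by simp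
    qed
    have "(\<Sum>(x, K)\<in>p - ?q. \<bar>measure lborel K * h x - ?W K\<bar>) \<le> (\<Sum>(x, K)\<in>p - ?q. e1 * (Sup K - Inf K))"
    proof (rule sum_mono)
      fix t assume "t \<in> p - ?q"
      then obtain x K where t: "t = (x, K)" and xK: "(x, K) \<in> p" and "x \<notin> E"
        by auto
      note m = tagged_division_member_real[OF p xK]
      have "K \<subseteq> {x - \<eta> x<..<x + \<eta> x}"
        using fine xK unfolding fine_def by blast
      then have "{Inf K, Sup K} \<subseteq> {x - \<eta> x<..<x + \<eta> x}"
        using m by (metis atLeastAtMost_iff empty_subsetI insert_subset order_refl order_trans subsetD)
      then have "x - d x < Inf K" "Sup K < x + d x"
        by (auto simp: \<eta>_def)
      then have "\<bar>measure lborel K * h x - ?W K\<bar> \<le> e1 * (Sup K - Inf K)"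
        using d(2)[of x "Inf K" "Sup K"] m \<open>x \<notin> E\<close> by auto
      then show "(case t of (x, K) \<Rightarrow> \<bar>measure lborel K * h x - ?W K\<bar>)
          \<le> (case t of (x, K) \<Rightarrow> e1 * (Sup K - Inf K))"
        by (simp add: t)
    qed
    also have "\<dots> \<le> (\<Sum>(x, K)\<in>p. e1 * (Sup K - Inf K))"
    proof (rule sum_mono2[OF fin])
      fix t assume "t \<in> p - (p - ?q)"
      then obtain x K where t: "t = (x, K)" "(x, K) \<in> p" by auto
      show "0 \<le> (case t of (x, K) \<Rightarrow> e1 * (Sup K - Inf K))"
        using tagged_division_member_real[OF p t(2)] e1(1) by (simp add: t(1))
    qed auto
    also have "\<dots> = e1 * (b - a)"
      using tele[of "\<lambda>x. e1 * x"] by (simp add: algebra_simps)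
    finally have R: "(\<Sum>(x, K)\<in>p - ?q. \<bar>measure lborel K * h x - ?W K\<bar>) \<le> \<epsilon> / 2"
      using e1(2) by simp
    have "(\<Sum>(x, K)\<in>p. measure lborel K *\<^sub>R h x) - (\<phi> b - \<phi> a) = (\<Sum>(x, K)\<in>p. measure lborel K * h x - ?W K)"
      by (simp add: tele[symmetric, of \<phi>] sum_subtractf[symmetric] case_prod_unfold)
    also have "norm \<dots> \<le> (\<Sum>(x, K)\<in>p. \<bar>measure lborel K * h x - ?W K\<bar>)"
      by (rule order_trans[OF norm_sum]) (simp add: case_prod_unfold)
    also have "\<dots> = (\<Sum>(x, K)\<in>p - ?q. \<bar>measure lborel K * h x - ?W K\<bar>)
        + (\<Sum>(x, K)\<in>?q. \<bar>measure lborel K * h x - ?W K\<bar>)"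
      by (rule sum.subset_diff[OF q fin])
    finally show ?thesis
      using E R by simp
  qed
  then show "\<exists>\<gamma>. gauge \<gamma> \<and> (\<forall>\<D>. \<D> tagged_division_of {a..b} \<and> \<gamma> fine \<D> \<longrightarrow>
      norm ((\<Sum>(x, k)\<in>\<D>. measure lborel k *\<^sub>R h x) - (\<phi> b - \<phi> a)) < \<epsilon>)"
    using \<gamma>(1) by blast
qed

section \<open>Substitution\<close>

lemma subst_integrand_eq:
  assumes "a < b" "x \<in> {a..b}" and D: "(g has_real_derivative D) (at x within {a..b})"
  shows "subst_integrand f g {a..b} x = f (g x) * D"
proof -
  have "real_derivative_on g {a..b} x = D"
    unfolding real_derivative_on_def
  proof (rule the_equality)
    show "(g has_real_derivative D) (at x within {a..b})" by (rule D)
    fix D' assume "(g has_real_derivative D') (at x within {a..b})"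
    then show "D' = D"
      using D assms(1,2) vector_derivative_unique_within_closed_interval[of a b x g D' D]
      by (simp add: has_real_derivative_iff_has_vector_derivative)
  qed
  moreover have "g differentiable (at x within {a..b})"
    using D by (auto simp: real_differentiable_def)
  ultimately show ?thesis
    by (simp add: subst_integrand_def)
qed

text \<open>
  Besides the points where \<open>g\<close> is not differentiable, the exceptional set contains the points
  with \<open>g' \<noteq> 0\<close> that \<open>g\<close> maps into the null set \<open>Z\<close> outside which \<open>F' = f\<close>. These form a null
  set: the set where \<open>g' \<noteq> 0\<close> is a countable union of pieces on each of which \<open>g\<close> locally has a
  Lipschitz inverse, and Lipschitz maps preserve null sets. Where \<open>g' = 0\<close> there is no such
  inverse: \<open>g\<close> may map a set of positive measure into \<open>Z\<close>, for example by being constant.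
\<close>

lemma hk_integral_comp_has_derivative_outside_negligible:
  assumes ab: "a < b"
    and g: "AE x in lebesgue_on {a..b}. g differentiable (at x within {a..b})"
    and f: "\<And>u v. u \<in> g ` {a..b} \<Longrightarrow> v \<in> g ` {a..b} \<Longrightarrow> u \<le> v \<Longrightarrow> f integrable_on {u..v}"
  obtains N where "negligible N" "N \<subseteq> {a..b}"
    and "\<And>x. x \<in> {a..b} - N - {x \<in> {a..b}. (g has_real_derivative 0) (at x within {a..b})} \<Longrightarrow>
      ((hk_integral f (g a) \<circ> g) has_real_derivative subst_integrand f g {a..b} x)
        (at x within {a..b})"
proof -
  obtain Z where Z: "negligible Z" "\<And>y. y \<in> g ` {a..b} - Z \<Longrightarrow>
      (hk_integral f (g a) has_real_derivative f y) (at y)"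
    using hk_integral_has_derivative_outside_negligible[of "g ` {a..b}" f "g a"] f ab by auto
  define S where "S = {x\<in>{a..b}. \<exists>D. D \<noteq> 0 \<and> (g has_real_derivative D) (at x within {a..b})}"
  define N1 where "N1 = {x\<in>{a..b}. \<not> g differentiable (at x within {a..b})}"
  define N2 where "N2 = {x\<in>S. g x \<in> Z}"
  have "AE x in lebesgue. x \<in> {a..b} \<longrightarrow> g differentiable (at x within {a..b})"
    using g by (simp add: AE_restrict_space_iff)
  then obtain M where M: "M \<in> null_sets lebesgue" "N1 \<subseteq> M"
    unfolding eventually_ae_filter N1_def by auto
  have N1: "negligible N1"
    using M negligible_iff_null_sets negligible_subset by blast
  \<comment> \<open>The preimage theorem wants derivatives relative to the set under consideration.\<close>
  have "\<exists>D. D \<noteq> 0 \<and> (g has_real_derivative D) (at x within S)" if "x \<in> S" for x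
    using that DERIV_subset[of g _ x "{a..b}" S] unfolding S_def by blast
  then obtain D where D: "\<And>x. x \<in> S \<Longrightarrow> D x \<noteq> 0"
    "\<And>x. x \<in> S \<Longrightarrow> (g has_real_derivative D x) (at x within S)"
    by metis
  have N2: "negligible N2"
    unfolding N2_def
  proof (rule negligible_differentiable_vimage[OF Z(1), where f' = "\<lambda>x. (*) (D x)"])
    show "inj ((*) (D x))" if "x \<in> S" for x
      using D(1)[OF that] by (simp add: inj_on_def)
  qed (use D(2) in \<open>simp add: has_field_derivative_def\<close>)
  show ?thesis
  proof
    show "negligible (N1 \<union> N2)"
      using N1 N2 by (rule negligible_Un)
    show "N1 \<union> N2 \<subseteq> {a..b}"
      by (auto simp: N1_def N2_def S_def)
  next
    fix x
    assume x: "x \<in> {a..b} - (N1 \<union> N2) -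
      {x \<in> {a..b}. (g has_real_derivative 0) (at x within {a..b})}"
    then obtain d where d: "(g has_real_derivative d) (at x within {a..b})"
      by (auto simp: N1_def real_differentiable_def)
    moreover from this have "d \<noteq> 0"
      using x by auto
    ultimately have "x \<in> S"
      using x by (auto simp: S_def)
    then have "g x \<notin> Z"
      using x by (auto simp: N2_def)
    then have "(hk_integral f (g a) has_real_derivative f (g x)) (at (g x))"
      using Z(2) x by auto
    then have "((hk_integral f (g a) \<circ> g) has_real_derivative f (g x) * d) (at x within {a..b})"
      using d by (rule DERIV_chain)
    then show "((hk_integral f (g a) \<circ> g) has_real_derivative subst_integrand f g {a..b} x)
        (at x within {a..b})"
      using subst_integrand_eq[OF ab _ d] x by auto
  qed
qed

theorem corollary3:
  fixes a b :: real and f g F :: "real \<Rightarrow> real"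
  assumes "a < b"
    and "AE x in lebesgue_on {a..b}. g differentiable (at x within {a..b})"
    and "\<And>u v. u \<in> g ` {a..b} \<Longrightarrow> v \<in> g ` {a..b} \<Longrightarrow> u \<le> v \<Longrightarrow> f integrable_on {u..v}"
  defines "F \<equiv> (\<lambda>x. hk_integral f (g a) x)"
  shows
    "(subst_integrand f g {a..b} integrable_on {a..b} \<and>
      (\<forall>\<alpha> \<beta>. a \<le> \<alpha> \<and> \<alpha> \<le> \<beta> \<and> \<beta> \<le> b \<longrightarrow>
         hk_integral f (g \<alpha>) (g \<beta>) = hk_integral (subst_integrand f g {a..b}) \<alpha> \<beta>))
     \<longleftrightarrow>
     ((\<forall>N. N \<in> null_sets lebesgue \<and> N \<subseteq> {a..b} \<longrightarrow> negligible_variation_on a b (F \<circ> g) N) \<and>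
      negligible_variation_on a b (F \<circ> g)
        {x \<in> {a..b}. (g has_real_derivative 0) (at x within {a..b})})"
proof -
  let ?h = "subst_integrand f g {a..b}"
  let ?C = "{x \<in> {a..b}. (g has_real_derivative 0) (at x within {a..b})}"
  have diff: "(F \<circ> g) v - (F \<circ> g) u = hk_integral f (g u) (g v)"
    if uv: "u \<in> {a..b}" "v \<in> {a..b}" for u v
  proof -
    define l r where "l = Min {g a, g u, g v}" and "r = Max {g a, g u, g v}"
    have "l \<in> {g a, g u, g v}" "r \<in> {g a, g u, g v}"
      unfolding l_def r_def by (intro Min_in Max_in; simp)+
    moreover have "{g a, g u, g v} \<subseteq> g ` {a..b}"
      using uv \<open>a < b\<close> by auto
    moreover have lr: "{g a, g u, g v} \<subseteq> {l..r}"
      by (auto simp: l_def r_def)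
    ultimately have "f integrable_on {l..r}"
      by (intro assms(3)) auto
    from hk_integral_additive[OF this, of "g a" "g u" "g v"] lr
    show ?thesis
      by (simp add: F_def)
  qed
  have C0: "?h x = 0" if "x \<in> ?C" for x
    using that subst_integrand_eq[OF \<open>a < b\<close>, of x g 0 f] by simp
  show ?thesis
  proof (intro iffI conjI allI impI; elim conjE)
    fix N
    assume h: "?h integrable_on {a..b}"
      and eq: "\<forall>\<alpha> \<beta>. a \<le> \<alpha> \<and> \<alpha> \<le> \<beta> \<and> \<beta> \<le> b \<longrightarrow> hk_integral f (g \<alpha>) (g \<beta>) = hk_integral ?h \<alpha> \<beta>"
      and N: "N \<in> null_sets lebesgue" "N \<subseteq> {a..b}"
    let ?k = "\<lambda>x. if x \<in> N then 0 else ?h x"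
    have neg: "negligible N"
      using N by (simp add: negligible_iff_null_sets)
    show "negligible_variation_on a b (F \<circ> g) N"
    proof (rule negligible_variation_on_indefinite_integral)
      show "?k integrable_on {a..b}"
        by (rule integrable_spike[OF h neg]) auto
      show "(F \<circ> g) v - (F \<circ> g) u = integral {u..v} ?k" if "a \<le> u" "u \<le> v" "v \<le> b" for u v
      proof -
        have "integral {u..v} ?h = integral {u..v} ?k"
          by (rule integral_spike[OF neg]) auto
        then show ?thesis
          using diff[of u v] eq that by (auto simp: hk_integral_def[of ?h])
      qed
    qed simp
  next
    assume h: "?h integrable_on {a..b}"
      and eq: "\<forall>\<alpha> \<beta>. a \<le> \<alpha> \<and> \<alpha> \<le> \<beta> \<and> \<beta> \<le> b \<longrightarrow> hk_integral f (g \<alpha>) (g \<beta>) = hk_integral ?h \<alpha> \<beta>"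
    show "negligible_variation_on a b (F \<circ> g) ?C"
      using h
    proof (rule negligible_variation_on_indefinite_integral)
      show "(F \<circ> g) v - (F \<circ> g) u = integral {u..v} ?h" if "a \<le> u" "u \<le> v" "v \<le> b" for u v
        using diff[of u v] eq that by (auto simp: hk_integral_def[of ?h])
    qed (rule C0)
  next
    assume null: "\<forall>N. N \<in> null_sets lebesgue \<and> N \<subseteq> {a..b} \<longrightarrow> negligible_variation_on a b (F \<circ> g) N"
      and C: "negligible_variation_on a b (F \<circ> g) ?C"
    obtain N where N: "negligible N" "N \<subseteq> {a..b}"
      and der: "\<And>x. x \<in> {a..b} - N - ?C \<Longrightarrow>
        ((F \<circ> g) has_real_derivative ?h x) (at x within {a..b})"
      using hk_integral_comp_has_derivative_outside_negligible[OF assms(1-3)] unfolding F_def by blast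
    let ?k = "\<lambda>x. if x \<in> N then 0 else ?h x"
    have nv: "negligible_variation_on a b (F \<circ> g) (N \<union> ?C)"
      using null C N by (intro negligible_variation_on_Un) (auto simp: negligible_iff_null_sets)
    have int: "(?h has_integral ((F \<circ> g) \<beta> - (F \<circ> g) \<alpha>)) {\<alpha>..\<beta>}"
      if "a \<le> \<alpha>" "\<alpha> \<le> \<beta>" "\<beta> \<le> b" for \<alpha> \<beta>
    proof (rule has_integral_spike[OF N(1)])
      show "(?k has_integral ((F \<circ> g) \<beta> - (F \<circ> g) \<alpha>)) {\<alpha>..\<beta>}"
      proof (rule has_integral_if_negligible_variation)
        show "negligible_variation_on \<alpha> \<beta> (F \<circ> g) (N \<union> ?C)"
          using nv that by (rule negligible_variation_on_subinterval)
        show "((F \<circ> g) has_real_derivative ?k x) (at x within {\<alpha>..\<beta>})"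
          if x: "x \<in> {\<alpha>..\<beta>} - (N \<union> ?C)" for x
        proof -
          have "((F \<circ> g) has_real_derivative ?h x) (at x within {a..b})"
            using x \<open>a \<le> \<alpha>\<close> \<open>\<beta> \<le> b\<close> by (intro der) auto
          then have "((F \<circ> g) has_real_derivative ?h x) (at x within {\<alpha>..\<beta>})"
            by (rule DERIV_subset) (use \<open>a \<le> \<alpha>\<close> \<open>\<beta> \<le> b\<close> in auto)
          then show ?thesis
            using x by simp
        qed
        show "?k x = 0" if "x \<in> N \<union> ?C" for x
          using that C0 by auto
      qed (rule that(2))
    qed auto
    show "?h integrable_on {a..b}"
      using int[of a b] \<open>a < b\<close> by auto
    show "hk_integral f (g \<alpha>) (g \<beta>) = hk_integral ?h \<alpha> \<beta>"
      if "a \<le> \<alpha>" "\<alpha> \<le> \<beta>" "\<beta> \<le> b" for \<alpha> \<beta>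
      using diff[of \<alpha> \<beta>] integral_unique[OF int[OF that]] that by (simp add: hk_integral_def[of ?h])
  qed
qed

end
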